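(* We have $r_3(N) = o(N)$ as $N \to \infty$; that is, $\lim_{N\to\infty} r_3(N)/N = 0$, where $r_3(N)$ denotes the largest size of a subset of $\{1,\dots,N\}$ containing no non-trivial three term arithmetic progression.
   Context: For an integer $N \geq 1$, $[N] := \{1,\dots,N\}$, and $r_3(N)$ denotes the size of any largest subset $S \subseteq [N]$ for which there are no solutions to $x + y = 2z$ with $x,y,z \in S$ and $x \neq y$ (i.e. $S$ has no non-trivial three term arithmetic progressions). *)

theory Defs
  imports Complex_Main "HOL-Library.Landau_Symbols"
begin

definition three_ap_free :: "nat set \<Rightarrow> bool" where
  "three_ap_free S \<longleftrightarrow> \<not> (\<exists>x\<in>S. \<exists>y\<in>S. \<exists>z\<in>S. x \<noteq> y \<and> x + y = 2 * z)"

definition r3 :: "nat \<Rightarrow> nat" where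
  "r3 N = Max {card S | S. S \<subseteq> {1..N} \<and> three_ap_free S}"

(* The maximum in r3 is taken over a finite nonempty set, so it is attained. *)

lemma finite_r3_cards: "finite {card S | S. S \<subseteq> {1..N} \<and> three_ap_free S}"
  by simp

lemma r3_cards_nonempty: "{card S | S. S \<subseteq> {1..N} \<and> three_ap_free S} \<noteq> {}"
  by (auto simp: three_ap_free_def intro!: exI[of _ "{}"])

end

theory Submission
  imports Defs
begin

text \<open>
  Szemeredi's combinatorial argument: let \<open>c\<close> be the limiting density of \<open>r3\<close> and suppose
  \<open>c > 0\<close>. An extremal set \<open>A\<close> in \<open>{1..6 * n}\<close> has about \<open>2 * c * n\<close> elements in the left third,
  and its part in \<open>{2 * n + 1..3 * n}\<close> contains a Hilbert cube of large dimension with bounded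
  steps. Reflecting the left part of \<open>A\<close> in the points of growing subcubes gives an increasing
  chain of sets that \<open>A\<close> must avoid, so one step of the chain adds few elements. The corresponding
  avoided set \<open>M\<close> is almost invariant under a bounded shift, and its complement splits into few
  arithmetic progressions, on each of which \<open>A\<close> has density at most about \<open>c\<close>. As \<open>M\<close> has positive
  density, \<open>A\<close> is too small.
\<close>

section \<open>Progression-free sets\<close>

lemma card_le_r3: "S \<subseteq> {1..N} \<Longrightarrow> three_ap_free S \<Longrightarrow> card S \<le> r3 N"
  unfolding r3_def by (rule Max_ge[OF finite_r3_cards]) blast

lemma r3_attained: obtains S where "S \<subseteq> {1..N}" "three_ap_free S" "card S = r3 N"
  using Max_in[OF finite_r3_cards r3_cards_nonempty, of N] unfolding r3_def by auto

lemma r3_le: "r3 N \<le> N"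
  by (metis r3_attained card_mono finite_atLeastAtMost card_atLeastAtMost diff_Suc_1)

text \<open>An injective affine map carries three term progressions to three term progressions, so
  the index set \<open>J\<close> is itself progression-free. Applying \<open>Suc\<close> moves the
  indices from \<open>{..<l}\<close> into \<open>{1..l}\<close>, the range used by
  \<open>r3\<close>.\<close>

lemma card_Int_progression_le:
  assumes "three_ap_free A" "d > 0"
  shows "card (A \<inter> (\<lambda>j. a + j * d) ` {..<l}) \<le> r3 l"
proof -
  let ?f = "\<lambda>j. a + j * d"
  define J where "J = {j \<in> {..<l}. ?f j \<in> A}"
  have inj: "inj_on ?f J"
    using assms(2) by (auto simp: inj_on_def)
  have "three_ap_free (Suc ` J)"
    unfolding three_ap_free_def
  proof (intro notI, elim bexE conjE)
    fix x y z assume "x \<in> Suc ` J" "y \<in> Suc ` J" "z \<in> Suc ` J" "x \<noteq> y" "x + y = 2 * z"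
    then obtain i j k where "i \<in> J" "j \<in> J" "k \<in> J" "x = Suc i" "y = Suc j" "z = Suc k"
      by blast
    with \<open>x \<noteq> y\<close> \<open>x + y = 2 * z\<close>
    have *: "i \<in> J" "j \<in> J" "k \<in> J" "i \<noteq> j" "i + j = 2 * k"
      by simp_all
    have "?f i + ?f j = 2 * a + (i + j) * d"
      by (simp add: algebra_simps)
    also have "\<dots> = 2 * ?f k"
      unfolding *(5) by (simp add: algebra_simps)
    finally have "?f i + ?f j = 2 * ?f k" .
    moreover have "?f i \<noteq> ?f j"
      using * inj by (auto simp: inj_on_def)
    ultimately show False
      using * assms(1) unfolding three_ap_free_def J_def by blast
  qed
  then have "card (Suc ` J) \<le> r3 l"
    by (intro card_le_r3) (auto simp: J_def)
  moreover have "A \<inter> ?f ` {..<l} = ?f ` J"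
    by (auto simp: J_def)
  ultimately show ?thesis
    by (simp add: card_image inj)
qed

lemma card_Int_interval_le:
  assumes "three_ap_free A"
  shows "card (A \<inter> {a+1..a+l}) \<le> r3 l"
proof -
  have "{a+1..a+l} = (\<lambda>j. (a + 1) + j * 1) ` {..<l}"
  proof (intro equalityI subsetI)
    fix x assume "x \<in> {a+1..a+l}"
    then show "x \<in> (\<lambda>j. (a + 1) + j * 1) ` {..<l}"
      by (intro image_eqI[of _ _ "x - (a + 1)"]) auto
  qed auto
  then show ?thesis
    using card_Int_progression_le[OF assms, of 1 "a + 1" l] by simp
qed

section \<open>Subadditivity of \<open>r3\<close> and its limiting density\<close>

lemma r3_add_le: "r3 (m + n) \<le> r3 m + r3 n"
proof -
  obtain S where S: "S \<subseteq> {1..m+n}" "three_ap_free S" "card S = r3 (m + n)"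
    by (rule r3_attained)
  have "S = (S \<inter> {0+1..0+m}) \<union> (S \<inter> {m+1..m+n})"
    using S(1) by auto
  then have "card S \<le> card (S \<inter> {0+1..0+m}) + card (S \<inter> {m+1..m+n})"
    by (metis card_Un_le)
  also have "\<dots> \<le> r3 m + r3 n"
    by (intro add_mono card_Int_interval_le S)
  finally show ?thesis
    using S(3) by simp
qed

lemma r3_mult_le: "r3 (q * l) \<le> q * r3 l"
proof (induction q)
  case 0
  then show ?case using r3_le[of 0] by simp
next
  case (Suc q)
  then show ?case using r3_add_le[of l "q * l"] by simp
qed

text \<open>By subadditivity (Fekete) this infimum is also the limit of the quotients; as an infimum
  it bounds every quotient from below at once. \<open>N = 0\<close> is left out because there the
  quotient is 0 by convention.\<close>

definition r3_density :: real where
  "r3_density = (INF N \<in> {1..}. real (r3 N) / real N)"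

lemma r3_density_le: "r3_density * real N \<le> real (r3 N)"
proof (cases "N = 0")
  case False
  have "r3_density \<le> real (r3 N) / real N"
    unfolding r3_density_def using False
    by (intro cINF_lower bdd_belowI2[of _ 0]) auto
  then show ?thesis
    using False by (simp add: field_simps)
qed simp

lemma r3_density_nonneg: "0 \<le> r3_density"
  unfolding r3_density_def by (intro cINF_greatest) auto

lemma r3_density_le_1: "r3_density \<le> 1"
  using r3_density_le[of 1] r3_le[of 1] by simp

text \<open>Fekete's argument: take \<open>l\<close> whose quotient is close to the infimum and cut
  \<open>{1..N}\<close> into blocks of length \<open>l\<close> and a remainder, which costs at most
  \<open>K = l\<close>. The error is the same constant for all \<open>N\<close>, so that a sum over
  many progressions costs \<open>K\<close> for each.\<close>

lemma r3_le_density: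
  assumes "\<epsilon> > 0"
  obtains K :: real where "K > 0" "\<And>N. real (r3 N) \<le> (r3_density + \<epsilon>) * real N + K"
proof -
  have "(INF N \<in> {1..}. real (r3 N) / real N) < r3_density + \<epsilon>"
    using assms unfolding r3_density_def by simp
  then obtain l :: nat where l: "l \<in> {1..}" "real (r3 l) / real l < r3_density + \<epsilon>"
    by (subst (asm) cINF_less_iff) (auto intro: bdd_belowI2[of _ 0])
  then have less: "real (r3 l) \<le> (r3_density + \<epsilon>) * real l"
    by (simp add: field_simps)
  show thesis
  proof
    show "real l > 0"
      using l by simp
    fix N :: nat
    have "r3 N \<le> r3 (N div l * l) + r3 (N mod l)"
      using r3_add_le[of "N div l * l" "N mod l"] by simp
    also have "\<dots> \<le> N div l * r3 l + l"
      using l r3_le[of "N mod l"] mod_less_divisor[of l N]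
      by (intro add_mono r3_mult_le) (auto intro: order.trans less_imp_le)
    finally have "real (r3 N) \<le> real (N div l) * real (r3 l) + real l"
      by (metis of_nat_add of_nat_le_iff of_nat_mult)
    also have "\<dots> \<le> real (N div l) * ((r3_density + \<epsilon>) * real l) + real l"
      by (intro add_mono mult_left_mono less) auto
    also have "\<dots> = (r3_density + \<epsilon>) * real (N div l * l) + real l"
      by simp
    also have "\<dots> \<le> (r3_density + \<epsilon>) * real N + real l"
      using r3_density_nonneg assms
      by (intro add_mono mult_left_mono of_nat_mono div_times_less_eq_dividend) auto
    finally show "real (r3 N) \<le> (r3_density + \<epsilon>) * real N + real l" .
  qed
qed

section \<open>Decomposition into progressions\<close>

text \<open>\<open>C\<close> is a disjoint union of maximal progressions with difference
  \<open>d\<close>, one for each \<open>y\<close> in \<open>C\<close> with \<open>y + d\<close>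
  outside \<open>C\<close>. Summing \<open>bound\<close> over them gives the claim; the induction
  removes one such progression at a time.\<close>

lemma card_le_of_progressions:
  fixes \<alpha> K :: real
  assumes "finite C" "A \<subseteq> C" "d > 0"
    and bound: "\<And>a l. real (card (A \<inter> (\<lambda>j. a + j * d) ` {..<l})) \<le> \<alpha> * real l + K"
  shows "real (card A) \<le> \<alpha> * real (card C) + K * real (card {y \<in> C. y + d \<notin> C})"
  using assms(1,2) bound
proof (induction C arbitrary: A rule: finite_psubset_induct)
  case (psubset C)
  show ?case
  proof (cases "C = {}")
    case False
    define y where "y = Max C"
    have y: "y \<in> C" "y + d \<notin> C"
      using psubset.hyps False \<open>d > 0\<close> Max_ge[of C "y + d"] by (auto simp: y_def)
    text \<open>The maximal progression in \<open>C\<close> with difference \<open>d\<close> that ends in \<open>y\<close>.\<close>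
    define a where "a = (LEAST a. \<exists>l. a + l * d = y \<and> (\<forall>j\<le>l. a + j * d \<in> C))"
    have "\<exists>l. a + l * d = y \<and> (\<forall>j\<le>l. a + j * d \<in> C)"
      unfolding a_def by (rule LeastI[of _ y]) (use y in \<open>auto intro: exI[of _ 0]\<close>)
    then obtain l where l: "a + l * d = y" "\<And>j. j \<le> l \<Longrightarrow> a + j * d \<in> C"
      by blast
    \<comment> \<open>Minimality of \<open>a\<close>: the progression cannot be prolonged to the
      left.\<close>
    have least: False if "b + d = a" "b \<in> C" for b
    proof -
      have "b + Suc l * d = y"
        using l that by auto
      moreover have "b + j * d \<in> C" if "j \<le> Suc l" for j
        using that \<open>b + d = a\<close> \<open>b \<in> C\<close> l(2)[of "j - 1"]
        by (cases j) (auto simp: algebra_simps)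
      ultimately have "a \<le> b"
        unfolding a_def by (intro Least_le) blast
      then show False
        using that \<open>d > 0\<close> by simp
    qed
    define P where "P = (\<lambda>j. a + j * d) ` {..<Suc l}"
    have PC: "P \<subseteq> C"
      using l by (auto simp: P_def)
    have cardP: "card P = Suc l"
      unfolding P_def using \<open>d > 0\<close> by (subst card_image) (auto simp: inj_on_def)
    have "y \<in> P"
      using l by (auto simp: P_def)
    let ?E = "\<lambda>C. {y \<in> C. y + d \<notin> C}"
    \<comment> \<open>Removing \<open>P\<close> loses the end \<open>y\<close> and creates no new
      end: for a new end \<open>z\<close>, \<open>z + d\<close> would lie in \<open>P\<close>, so
      \<open>z\<close> would precede \<open>a\<close> or lie in \<open>P\<close>.\<close>
    have "?E (C - P) \<subseteq> ?E C - {y}"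
    proof
      fix z assume z: "z \<in> ?E (C - P)"
      have "z + d \<notin> P"
      proof
        assume "z + d \<in> P"
        then obtain j where j: "j \<le> l" "z + d = a + j * d"
          unfolding P_def by (metis (no_types, lifting) imageE lessThan_iff less_Suc_eq_le)
        show False
        proof (cases j)
          case 0
          then show ?thesis using j z least[of z] by auto
        next
          case (Suc i)
          then have "z = a + i * d" "i < Suc l"
            using j by auto
          then show ?thesis using z by (auto simp: P_def)
        qed
      qed
      then show "z \<in> ?E C - {y}"
        using z \<open>y \<in> P\<close> by auto
    qed
    then have "card (?E (C - P)) \<le> card (?E C - {y})"
      using psubset.hyps by (intro card_mono) auto
    also have "\<dots> < card (?E C)"
      using psubset.hyps y by (intro card_Diff1_less) auto
    finally have ends: "real (card (?E (C - P))) \<le> real (card (?E C)) - 1"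
      by linarith
    \<comment> \<open>The empty progression, \<open>l = 0\<close>, gives the sign of
      \<open>K\<close>.\<close>
    have "K \<ge> 0"
      using psubset.prems(2)[of 0 0] by simp
    have "real (card (A - P)) \<le> \<alpha> * real (card (C - P)) + K * real (card (?E (C - P)))"
    proof (rule psubset.IH)
      show "C - P \<subset> C" "A - P \<subseteq> C - P"
        using \<open>y \<in> P\<close> PC psubset.prems(1) by auto
      fix b k
      have "card ((A - P) \<inter> (\<lambda>j. b + j * d) ` {..<k}) \<le> card (A \<inter> (\<lambda>j. b + j * d) ` {..<k})"
        by (intro card_mono) auto
      then show "real (card ((A - P) \<inter> (\<lambda>j. b + j * d) ` {..<k})) \<le> \<alpha> * real k + K"
        using psubset.prems(2)[of b k] by linarith
    qed
    also have "\<dots> \<le> \<alpha> * real (card (C - P)) + K * (real (card (?E C)) - 1)"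
      by (intro add_left_mono mult_left_mono ends \<open>K \<ge> 0\<close>)
    finally have "real (card (A - P)) \<le> \<dots>" .
    moreover have "real (card (A \<inter> P)) \<le> \<alpha> * real (card P) + K"
      using psubset.prems(2)[of a "Suc l"] cardP by (simp add: P_def)
    moreover have "card A = card (A - P) + card (A \<inter> P)"
      using psubset.prems(1) psubset.hyps finite_subset card_Diff_subset_Int[of A P]
      by (metis Int_commute add.commute card_Int_Diff)
    moreover have "real (card C) = real (card (C - P)) + real (card P)"
      using PC psubset.hyps card_Int_Diff[of C P] by (simp add: Int_absorb1)
    ultimately show ?thesis
      by (simp add: algebra_simps)
  qed (use psubset.prems in auto)
qed

section \<open>Hilbert cubes\<close>

text \<open>The Hilbert cube of all sums of \<open>m\<close> and a sublist of the steps. The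
  suffixes of the list of steps give a growing chain of subcubes with the same base point.\<close>

fun cube :: "nat \<Rightarrow> nat list \<Rightarrow> nat set" where
  "cube m [] = {m}"
| "cube m (x # xs) = cube m xs \<union> (+) x ` cube m xs"

lemma cube_nonempty: "cube m xs \<noteq> {}"
  by (induction xs) auto

text \<open>A block of \<open>D\<close> consecutive integers holds at most one element of
  \<open>B\<close> with no other element of \<open>B\<close> among the next \<open>D\<close>
  integers. For large \<open>D\<close> such elements are few, and pigeonhole over the
  \<open>D\<close> possible differences treats the rest.\<close>

lemma exists_frequent_difference:
  fixes \<delta> :: real
  assumes "\<delta> > 0"
  obtains D :: nat and n\<^sub>0 :: nat where "D > 0"
    "\<And>n B. n \<ge> n\<^sub>0 \<Longrightarrow> B \<subseteq> {..n} \<Longrightarrow> real (card B) \<ge> \<delta> * real n \<Longrightarrow>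
      \<exists>x\<in>{1..D}. real (card {b \<in> B. b + x \<in> B}) \<ge> \<delta> / (2 * real D) * real n"
proof -
  \<comment> \<open>With this \<open>D\<close> and \<open>n > D\<close>, both \<open>n / D\<close>
    and \<open>1\<close> are at most \<open>\<delta> / 4 * n\<close>, so at least half of the
    guaranteed \<open>\<delta> * n\<close> elements survive.\<close>
  define D where "D = nat \<lceil>4 / \<delta>\<rceil>"
  have D: "real D \<ge> 4 / \<delta>"
    unfolding D_def by linarith
  have "4 / \<delta> > 0"
    using assms by simp
  with D have "real D > 0" by linarith
  then have "D > 0" by simp
  have "\<exists>x\<in>{1..D}. real (card {b \<in> B. b + x \<in> B}) \<ge> \<delta> / (2 * real D) * real n"
    if n: "n \<ge> Suc D" and B: "B \<subseteq> {..n}" "real (card B) \<ge> \<delta> * real n" for n B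
  proof (rule ccontr)
    assume contra: "\<not> ?thesis"
    have *: "4 \<le> \<delta> * real D"
      using D assms by (simp add: field_simps)
    have fin: "finite B"
      using B finite_subset by blast
    define G where "G = (\<Union>x\<in>{1..D}. {b \<in> B. b + x \<in> B})"
    have "G \<subseteq> B"
      by (auto simp: G_def)
    have "inj_on (\<lambda>b. b div D) (B - G)"
    proof (rule linorder_inj_onI)
      fix b b' assume *: "b < b'" "b \<in> B - G" "b' \<in> B - G"
      show "b div D \<noteq> b' div D"
      proof
        assume "b div D = b' div D"
        then have "b div D * D + b' mod D = b'"
          by simp
        then have "b' < b + D"
          using div_mult_mod_eq[of b D] mod_less_divisor[OF \<open>D > 0\<close>, of b'] by linarith
        then have "b' - b \<in> {1..D}" "b + (b' - b) \<in> B"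
          using * by auto
        then show False
          using * unfolding G_def by blast
      qed
    qed auto
    moreover have "(\<lambda>b. b div D) ` (B - G) \<subseteq> {..n div D}"
      using B by (auto intro: div_le_mono)
    ultimately have "card (B - G) \<le> card {..n div D}"
      by (intro card_inj_on_le) auto
    then have "real (card (B - G)) \<le> real (n div D) + 1"
      by simp
    also have "real (n div D) \<le> real n / real D"
      by (rule of_nat_div_le_of_nat)
    also have "real n / real D \<le> \<delta> / 4 * real n"
      using mult_right_mono[OF *, of "real n"] \<open>D > 0\<close> by (simp add: field_simps)
    also have "1 \<le> \<delta> / 4 * real n"
    proof -
      have "\<delta> * real D \<le> \<delta> * real n"
        using n assms by (intro mult_left_mono) auto
      with * show ?thesis
        by simp
    qed
    finally have bad: "real (card (B - G)) \<le> \<delta> / 2 * real n"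
      by simp
    have "card G \<le> (\<Sum>x\<in>{1..D}. card {b \<in> B. b + x \<in> B})"
      unfolding G_def by (rule card_UN_le) simp
    then have "real (card G) \<le> (\<Sum>x\<in>{1..D}. real (card {b \<in> B. b + x \<in> B}))"
      unfolding of_nat_sum[symmetric] of_nat_le_iff .
    also have "\<dots> < (\<Sum>x\<in>{1..D}. \<delta> / (2 * real D) * real n)"
      using contra \<open>D > 0\<close> by (intro sum_strict_mono) (auto simp: not_le)
    also have "\<dots> = \<delta> / 2 * real n"
      using \<open>D > 0\<close> by simp
    finally have "real (card G) < \<delta> / 2 * real n" .
    moreover have "real (card B) = real (card G) + real (card (B - G))"
      using card_Int_Diff[OF fin, of G] \<open>G \<subseteq> B\<close> by (simp add: Int_absorb1)
    ultimately show False
      using bad B by linarith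
  qed
  with \<open>D > 0\<close> show thesis
    using that by blast
qed

text \<open>A cube in \<open>{b \<in> B. b + x \<in> B}\<close> together with its translate by
  \<open>x\<close> is a cube in \<open>B\<close> of one dimension more. The density falls to
  \<open>\<delta> / (2 * D)\<close>, hence the induction over all \<open>\<delta>\<close>. The bound
  on the steps does not depend on \<open>n\<close>.\<close>

lemma dense_contains_cube:
  fixes \<delta> :: real
  assumes "\<delta> > 0"
  shows "\<exists>D n\<^sub>0. \<forall>n\<ge>n\<^sub>0. \<forall>B\<subseteq>{..n}. real (card B) \<ge> \<delta> * real n \<longrightarrow>
    (\<exists>m xs. length xs = k \<and> set xs \<subseteq> {1..D} \<and> cube m xs \<subseteq> B)"
  using assms
proof (induction k arbitrary: \<delta>)
  case 0
  have "\<exists>m xs. length xs = 0 \<and> set xs \<subseteq> {1..0} \<and> cube m xs \<subseteq> B"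
    if n: "n \<ge> 1" and B: "real (card B) \<ge> \<delta> * real n" for n :: nat and B :: "nat set"
  proof -
    have "\<delta> * real n > 0"
      using 0 n by simp
    with B have "B \<noteq> {}"
      by auto
    then show ?thesis
      by auto
  qed
  then show ?case
    by blast
next
  case (Suc k)
  obtain D n\<^sub>0 where D: "D > 0"
    "\<And>n B. n \<ge> n\<^sub>0 \<Longrightarrow> B \<subseteq> {..n} \<Longrightarrow> real (card B) \<ge> \<delta> * real n \<Longrightarrow>
      \<exists>x\<in>{1..D}. real (card {b \<in> B. b + x \<in> B}) \<ge> \<delta> / (2 * real D) * real n"
    by (rule exists_frequent_difference[OF Suc.prems]) (rule that)
  then have "\<delta> / (2 * real D) > 0"
    using Suc.prems by simp
  from Suc.IH[OF this] obtain D' n\<^sub>1 where D':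
    "\<forall>n\<ge>n\<^sub>1. \<forall>B\<subseteq>{..n}. real (card B) \<ge> \<delta> / (2 * real D) * real n \<longrightarrow>
      (\<exists>m xs. length xs = k \<and> set xs \<subseteq> {1..D'} \<and> cube m xs \<subseteq> B)"
    by (elim exE)
  have "\<exists>m xs. length xs = Suc k \<and> set xs \<subseteq> {1..max D D'} \<and> cube m xs \<subseteq> B"
    if n: "n \<ge> max n\<^sub>0 n\<^sub>1" and B: "B \<subseteq> {..n}" "real (card B) \<ge> \<delta> * real n" for n B
  proof -
    obtain x where x: "x \<in> {1..D}" "real (card {b \<in> B. b + x \<in> B}) \<ge> \<delta> / (2 * real D) * real n"
      using D(2)[of n B] n B by auto
    moreover have "{b \<in> B. b + x \<in> B} \<subseteq> {..n}"
      using B by auto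
    ultimately obtain m xs where "length xs = k" "set xs \<subseteq> {1..D'}" "cube m xs \<subseteq> {b \<in> B. b + x \<in> B}"
      using D'[rule_format, of n "{b \<in> B. b + x \<in> B}"] n by auto
    then have "length (x # xs) = Suc k" "set (x # xs) \<subseteq> {1..max D D'}" "cube m (x # xs) \<subseteq> B"
      using x(1) by (force simp: add.commute)+
    then show ?thesis
      by blast
  qed
  then show ?case
    by blast
qed

section \<open>Reflections in a cube\<close>

text \<open>\<open>2 * m - x\<close> completes \<open>x\<close>, \<open>m\<close> to a three term
  progression. The truncated subtraction is harmless where it is used, since there
  \<open>x \<le> m\<close>.\<close>

definition reflections :: "nat set \<Rightarrow> nat set \<Rightarrow> nat set" where
  "reflections M X = {2 * m - x | m x. m \<in> M \<and> x \<in> X}"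

text \<open>Moving the midpoint by \<open>y\<close> moves the reflected point by
  \<open>2 * y\<close>.\<close>

lemma reflections_cube_Cons:
  assumes "\<And>m x. m \<in> cube m\<^sub>0 xs \<Longrightarrow> x \<in> X \<Longrightarrow> x \<le> m"
  shows "reflections (cube m\<^sub>0 (y # xs)) X =
    reflections (cube m\<^sub>0 xs) X \<union> (\<lambda>u. u + 2 * y) ` reflections (cube m\<^sub>0 xs) X"
proof -
  have shift: "2 * (y + m) - x = (2 * m - x) + 2 * y" if "m \<in> cube m\<^sub>0 xs" "x \<in> X" for m x
    using assms[OF that] by simp
  have "reflections ((+) y ` cube m\<^sub>0 xs) X = (\<Union>m\<in>cube m\<^sub>0 xs. \<Union>x\<in>X. {2 * (y + m) - x})"
    unfolding reflections_def by blast
  also have "\<dots> = (\<Union>m\<in>cube m\<^sub>0 xs. \<Union>x\<in>X. {(2 * m - x) + 2 * y})"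
    by (simp only: shift cong: SUP_cong)
  also have "\<dots> = (\<lambda>u. u + 2 * y) ` reflections (cube m\<^sub>0 xs) X"
    unfolding reflections_def by blast
  finally have "reflections ((+) y ` cube m\<^sub>0 xs) X =
    (\<lambda>u. u + 2 * y) ` reflections (cube m\<^sub>0 xs) X" .
  moreover have "reflections (S \<union> T) X = reflections S X \<union> reflections T X" for S T
    unfolding reflections_def by blast
  ultimately show ?thesis
    by simp
qed

text \<open>Reflection in a single point of \<open>M\<close> is already injective on
  \<open>X\<close>.\<close>

lemma card_le_card_reflections:
  assumes "finite M" "finite X" "M \<noteq> {}" "\<And>m x. m \<in> M \<Longrightarrow> x \<in> X \<Longrightarrow> x \<le> m"
  shows "card X \<le> card (reflections M X)"
proof -
  obtain m where m: "m \<in> M"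
    using assms by blast
  have "reflections M X = (\<lambda>(m, x). 2 * m - x) ` (M \<times> X)"
    by (auto simp: reflections_def)
  then have "finite (reflections M X)"
    using assms by simp
  moreover have "inj_on (\<lambda>x. 2 * m - x) X"
  proof (rule inj_onI)
    fix x y assume "x \<in> X" "y \<in> X" "2 * m - x = 2 * m - y"
    then show "x = y"
      using assms(4)[OF m, of x] assms(4)[OF m, of y] by linarith
  qed
  moreover have "(\<lambda>x. 2 * m - x) ` X \<subseteq> reflections M X"
    using m by (auto simp: reflections_def)
  ultimately show ?thesis
    by (metis card_inj_on_le)
qed

section \<open>Small steps of the chain and the gaps they leave\<close>

text \<open>Pigeonhole along the suffixes: if each step added at least \<open>t\<close>, the total
  would reach \<open>length xs * t\<close>.\<close>

lemma exists_small_increment: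
  fixes F :: "'a list \<Rightarrow> nat"
  assumes "F xs < length xs * t"
  shows "\<exists>x ys zs. xs = zs @ x # ys \<and> F (x # ys) < F ys + t"
  using assms
proof (induction xs)
  case (Cons x xs)
  show ?case
  proof (cases "F (x # xs) < F xs + t")
    case True
    then show ?thesis
      by (metis append_Nil)
  next
    case False
    then have "F xs < length xs * t"
      using Cons.prems by simp
    from Cons.IH[OF this] show ?thesis
      by (metis append_Cons)
  qed
qed simp

lemma cube_suffix_subset: "cube m ys \<subseteq> cube m (zs @ ys)"
  by (induction zs) auto

lemma finite_cube: "finite (cube m xs)"
  by (induction xs) auto

text \<open>At an end \<open>y\<close> of the complement, either \<open>y + d\<close> lies in
  \<open>M\<close> or \<open>y + d > N\<close>. The first kind injects into \<open>M\<close> minus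
  its translate, which has as many elements as the translate minus \<open>M\<close>, hence at most
  \<open>t\<close>; the second kind has at most \<open>d\<close> elements.\<close>

lemma card_gap_ends_le:
  fixes M :: "nat set"
  assumes "finite M" "M \<union> (\<lambda>u. u + d) ` M \<subseteq> {1..N}"
    and "card (M \<union> (\<lambda>u. u + d) ` M) \<le> card M + t"
  shows "card {y \<in> {1..N} - M. y + d \<notin> {1..N} - M} \<le> t + d"
proof -
  let ?s = "\<lambda>u. u + d"
  have inj: "inj_on ?s S" for S
    by (auto simp: inj_on_def)
  define W where "W = {y. y \<notin> M \<and> y + d \<in> M}"
  have sub: "?s ` W \<subseteq> M - ?s ` M"
    by (auto simp: W_def)
  have finW: "finite W"
    using finite_imageD[OF _ inj] finite_subset[OF sub] assms(1) by blast
  have "card W = card (?s ` W)"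
    by (simp add: card_image inj)
  also have "\<dots> \<le> card (M - ?s ` M)"
    using assms(1) by (intro card_mono sub) auto
  also have "\<dots> = card (?s ` M \<union> M) - card (?s ` M)"
    using assms(1) card_Un_disjoint[of "?s ` M" "M - ?s ` M"] by simp
  also have "\<dots> \<le> t"
    using assms(3) by (simp add: card_image inj Un_commute)
  finally have "card W \<le> t" .
  have "{y \<in> {1..N} - M. y + d \<notin> {1..N} - M} \<subseteq> W \<union> {N - d<..N}"
    by (auto simp: W_def)
  then have "card {y \<in> {1..N} - M. y + d \<notin> {1..N} - M} \<le> card (W \<union> {N - d<..N})"
    using finW by (intro card_mono) auto
  also have "\<dots> \<le> card W + card {N - d<..N}"
    by (rule card_Un_le)
  also have "\<dots> \<le> t + d"
    using \<open>card W \<le> t\<close> by simp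
  finally show ?thesis .
qed

section \<open>The density is zero\<close>

text \<open>The combinatorial core. A small step \<open>x\<close> of the chain yields a set
  \<open>M\<close> avoided by \<open>A\<close>, with at least as many elements as the left third of
  \<open>A\<close>; \<open>A\<close> is then counted on the complement along progressions with
  difference \<open>2 * x\<close>.\<close>

lemma card_le_of_cube:
  fixes \<alpha> K :: real
  assumes A: "A \<subseteq> {1..6*n}" "three_ap_free A"
    and r3: "\<And>l. real (r3 l) \<le> \<alpha> * real l + K" and "\<alpha> \<ge> 0" "K \<ge> 0"
    and xs: "set xs \<subseteq> {1..D}" "cube m xs \<subseteq> A \<inter> {2*n+1..2*n+n}"
    and t: "6 * n < length xs * t"
  shows "real (card A) \<le>
    \<alpha> * (6 * real n - real (card (A \<inter> {0+1..0+2*n}))) + K * (real t + 2 * real D)"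
proof -
  define X where "X = A \<inter> {0+1..0+2*n}"
  define R where "R ys = reflections (cube m ys) X" for ys
  \<comment> \<open>Since \<open>x \<le> 2 * n < p \<le> 3 * n\<close>, the reflected point is at
    most \<open>6 * n\<close>, and the progression \<open>x\<close>, \<open>p\<close>,
    \<open>u\<close> is non-trivial.\<close>
  have range: "reflections Q X \<subseteq> {1..6*n} - A" if Q: "Q \<subseteq> cube m xs" for Q
  proof
    fix u assume "u \<in> reflections Q X"
    then obtain p x where px: "p \<in> Q" "x \<in> X" "u = 2 * p - x"
      by (auto simp: reflections_def)
    then have *: "p \<in> A" "2 * n < p" "p \<le> 3 * n" "x \<in> A" "1 \<le> x" "x \<le> 2 * n"
      using Q xs by (auto simp: X_def)
    then have "x + u = 2 * p" "x \<noteq> u"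
      using px by linarith+
    then have "u \<notin> A"
      using A(2) * unfolding three_ap_free_def by blast
    then show "u \<in> {1..6*n} - A"
      using px * by auto
  qed
  have "card (R xs) \<le> card {1..6*n}"
    using range[of "cube m xs"] by (intro card_mono) (auto simp: R_def)
  then have "card (R xs) < length xs * t"
    using t by simp
  from exists_small_increment[of "\<lambda>ys. card (R ys)", OF this]
  obtain x ys zs where ys: "xs = zs @ x # ys" "card (R (x # ys)) < card (R ys) + t"
    by blast
  have sub': "cube m (x # ys) \<subseteq> cube m xs"
    using cube_suffix_subset ys(1) by metis
  then have sub: "cube m ys \<subseteq> cube m xs"
    by auto
  have le: "u \<le> p" if "p \<in> cube m ys" "u \<in> X" for p u
    using that sub xs by (force simp: X_def)
  \<comment> \<open>Adjoining the step \<open>x\<close> adds to \<open>M\<close> its translate by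
    \<open>2 * x\<close>, which contributes fewer than \<open>t\<close> new points.\<close>
  define M where "M = R ys"
  have "R (x # ys) = M \<union> (\<lambda>u. u + 2 * x) ` M"
    unfolding R_def M_def by (intro reflections_cube_Cons le)
  then have M: "M \<union> (\<lambda>u. u + 2 * x) ` M \<subseteq> {1..6*n} - A"
      "card (M \<union> (\<lambda>u. u + 2 * x) ` M) \<le> card M + t"
    using range[OF sub'] ys(2) by (auto simp: R_def M_def)
  have finM: "finite M"
    using M(1) finite_subset by (metis Un_upper1 finite_Diff finite_atLeastAtMost)
  define C where "C = {1..6*n} - M"
  have "x \<in> {1..D}"
    using ys(1) xs(1) by auto
  have "card {y \<in> C. y + 2 * x \<notin> C} \<le> t + 2 * x"
    unfolding C_def using M by (intro card_gap_ends_le finM) auto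
  also have "\<dots> \<le> t + 2 * D"
    using \<open>x \<in> {1..D}\<close> by simp
  finally have ends: "real (card {y \<in> C. y + 2 * x \<notin> C}) \<le> real t + 2 * real D"
    by linarith
  have "card X \<le> card M"
    unfolding M_def R_def
    by (intro card_le_card_reflections finite_cube cube_nonempty le) (auto simp: X_def)
  moreover have "card C = 6 * n - card M"
    unfolding C_def using M(1) finM by (subst card_Diff_subset) auto
  moreover have "card M \<le> card {1..6*n}"
    using M(1) by (intro card_mono) auto
  ultimately have cardC: "real (card C) \<le> 6 * real n - real (card X)"
    by simp
  have "real (card A) \<le> \<alpha> * real (card C) + K * real (card {y \<in> C. y + 2 * x \<notin> C})"
  proof (rule card_le_of_progressions)
    show "finite C" "A \<subseteq> C" "2 * x > 0"
      using A(1) M(1) \<open>x \<in> {1..D}\<close> by (auto simp: C_def)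
    fix a l
    show "real (card (A \<inter> (\<lambda>j. a + j * (2 * x)) ` {..<l})) \<le> \<alpha> * real l + K"
      using card_Int_progression_le[OF A(2) \<open>2 * x > 0\<close>, of a l] r3[of l] by linarith
  qed
  also have "\<dots> \<le> \<alpha> * (6 * real n - real (card X)) + K * (real t + 2 * real D)"
    using \<open>\<alpha> \<ge> 0\<close> \<open>K \<ge> 0\<close> by (intro add_mono mult_left_mono cardC ends)
  finally show ?thesis
    by (simp add: X_def)
qed

lemma r3_density_eq_0: "r3_density = 0"
proof (rule ccontr)
  assume "r3_density \<noteq> 0"
  define c where "c = r3_density"
  have c: "0 < c" "c \<le> 1"
    using r3_density_nonneg r3_density_le_1 \<open>r3_density \<noteq> 0\<close> by (auto simp: c_def)
  \<comment> \<open>Chosen so that the loss \<open>6 * \<epsilon> * n\<close> is only a third of the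
    gain \<open>c\<^sup>2 * n\<close>.\<close>
  define \<epsilon> where "\<epsilon> = c\<^sup>2 / 18"
  have \<epsilon>: "0 < \<epsilon>" "\<epsilon> \<le> c / 18"
    using c by (auto simp: \<epsilon>_def power2_eq_square mult_left_le)
  obtain K where K: "K > 0" "\<And>N. real (r3 N) \<le> (c + \<epsilon>) * real N + K"
    using r3_le_density[OF \<epsilon>(1)] unfolding c_def by blast
  \<comment> \<open>The dimension makes the cost \<open>K * 6 * n / k\<close> of the progressions at
    most \<open>c\<^sup>2 * n / 12\<close>.\<close>
  define k where "k = nat \<lceil>72 * K / c\<^sup>2\<rceil> + 1"
  have k: "real k \<ge> 72 * K / c\<^sup>2"
    unfolding k_def by linarith
  have "k > 0"
    by (simp add: k_def)
  obtain D n\<^sub>0 where D: "\<And>n B. n \<ge> n\<^sub>0 \<Longrightarrow> B \<subseteq> {..n} \<Longrightarrow> real (card B) \<ge> c / 12 * real n \<Longrightarrow>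
      \<exists>m xs. length xs = k \<and> set xs \<subseteq> {1..D} \<and> cube m xs \<subseteq> B"
    using dense_contains_cube[of "c / 12" k] c by (metis divide_pos_pos zero_less_numeral)
  \<comment> \<open>The summands ensure in turn that \<open>n\<close> exceeds the threshold for
    cubes, that \<open>2 * K\<close> is at most \<open>c * n / 4\<close>, and that
    \<open>K * (2 + 2 * D)\<close> is at most \<open>c\<^sup>2 * n / 6\<close>.\<close>
  define n where "n = n\<^sub>0 + nat \<lceil>8 * K / c\<rceil> + nat \<lceil>6 * (K * (2 + 2 * real D)) / c\<^sup>2\<rceil> + 1"
  have "real n \<ge> 8 * K / c"
    unfolding n_def by linarith
  then have n1: "8 * K \<le> c * real n"
    using c by (simp add: field_simps)
  have "real n \<ge> 6 * (K * (2 + 2 * real D)) / c\<^sup>2"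
    unfolding n_def by linarith
  then have n2: "6 * (K * (2 + 2 * real D)) \<le> c\<^sup>2 * real n"
    using c by (simp add: field_simps)
  have n: "n > 0" "3 * n \<ge> n\<^sub>0"
    by (auto simp: n_def)
  obtain A where A: "A \<subseteq> {1..6*n}" "three_ap_free A" "card A = r3 (6*n)"
    by (rule r3_attained)
  define X where "X = A \<inter> {0+1..0+2*n}"
  define B where "B = A \<inter> {2*n+1..2*n+n}"
  define Y where "Y = A \<inter> {3*n+1..3*n+3*n}"
  have "A = X \<union> (B \<union> Y)"
    using A(1) by (auto simp: X_def B_def Y_def)
  moreover have "X \<inter> (B \<union> Y) = {}" "B \<inter> Y = {}" "finite X" "finite B" "finite Y"
    by (auto simp: X_def B_def Y_def)
  ultimately have split: "card A = card X + (card B + card Y)"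
    by (simp add: card_Un_disjoint)
  have X: "real (card X) \<le> (c + \<epsilon>) * (2 * real n) + K"
    using card_Int_interval_le[OF A(2), of 0 "2*n"] K(2)[of "2*n"] by (simp add: X_def)
  have B: "real (card B) \<le> (c + \<epsilon>) * real n + K"
    using card_Int_interval_le[OF A(2), of "2*n" n] K(2)[of n] by (simp add: B_def)
  have Y: "real (card Y) \<le> (c + \<epsilon>) * (3 * real n) + K"
    using card_Int_interval_le[OF A(2), of "3*n" "3*n"] K(2)[of "3*n"] by (simp add: Y_def)
  have lower: "6 * (c * real n) \<le> real (card A)"
    using r3_density_le[of "6*n"] A(3) by (simp add: c_def)
  have \<epsilon>n: "18 * (\<epsilon> * real n) \<le> c * real n"
    using \<epsilon>(2) n by (simp add: field_simps)
  \<comment> \<open>No part of \<open>A\<close> much exceeds its share by density, so none falls far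
    below it. The weaker bounds \<open>c * n\<close> for \<open>X\<close> and
    \<open>c * n / 4\<close> for \<open>B\<close> suffice.\<close>
  have cardX: "c * real n \<le> real (card X)"
    using split lower B Y \<epsilon>n n1 by (simp add: algebra_simps)
  have "c / 12 * real (3 * n) \<le> real (card B)"
    using split lower X Y \<epsilon>n n1 by (simp add: algebra_simps)
  moreover have "B \<subseteq> {..3*n}"
    by (auto simp: B_def)
  ultimately obtain m xs where xs: "length xs = k" "set xs \<subseteq> {1..D}" "cube m xs \<subseteq> B"
    using D[of "3*n" B] n by blast
  define t where "t = 6 * n div k + 1"
  have "6 * n < k * t"
    using dividend_less_times_div[OF \<open>k > 0\<close>, of "6 * n"] by (simp add: t_def)
  have "real (card A) \<le> (c + \<epsilon>) * (6 * real n - real (card X)) + K * (real t + 2 * real D)"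
    unfolding X_def
  proof (rule card_le_of_cube)
    show "6 * n < length xs * t"
      using \<open>6 * n < k * t\<close> xs by simp
  qed (use A K c \<epsilon> xs in \<open>auto simp: B_def\<close>)
  also have "\<dots> \<le> (c + \<epsilon>) * (6 * real n - c * real n) + K * (real t + 2 * real D)"
    using c \<epsilon> cardX K(1) by (intro add_mono mult_left_mono) auto
  \<comment> \<open>The term \<open>- c\<^sup>2 * n\<close> is the gain from avoiding
    \<open>M\<close>. The two losses, a third and a quarter of it, do not cancel it, against the
    lower bound for \<open>card A\<close>.\<close>
  also have "(c + \<epsilon>) * (6 * real n - c * real n) \<le>
      6 * (c * real n) - c\<^sup>2 * real n + 6 * (\<epsilon> * real n)"
    using c \<epsilon> by (simp add: algebra_simps power2_eq_square)
  also have "6 * (\<epsilon> * real n) = c\<^sup>2 * real n / 3"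
    by (simp add: \<epsilon>_def)
  also have "K * (real t + 2 * real D) \<le> c\<^sup>2 * real n / 4"
  proof -
    have "real t \<le> real (6 * n) / real k + 1"
      unfolding t_def using of_nat_div_le_of_nat[of "6*n" k, where 'a = real] by simp
    then have "K * (real t + 2 * real D) \<le> K * (real (6 * n) / real k + 1 + 2 * real D)"
      using K(1) by (intro mult_left_mono) auto
    also have "\<dots> \<le> K * (real (6 * n) / real k) + K * (2 + 2 * real D)"
      using K(1) by (simp add: algebra_simps)
    also have "K * (real (6 * n) / real k) \<le> c\<^sup>2 * real n / 12"
    proof -
      have "72 * K \<le> c\<^sup>2 * real k"
        using k c by (simp add: field_simps)
      then have "72 * K * real n \<le> c\<^sup>2 * real k * real n"
        by (rule mult_right_mono) simp
      then show ?thesis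
        using \<open>k > 0\<close> by (simp add: field_simps)
    qed
    finally show ?thesis
      using n2 by linarith
  qed
  finally have "c\<^sup>2 * real n \<le> c\<^sup>2 * real n / 3 + c\<^sup>2 * real n / 4"
    using lower by linarith
  moreover have "c\<^sup>2 * real n > 0"
    using c n by simp
  ultimately show False
    by linarith
qed

theorem theorem1p1:
  shows "(\<lambda>N. real (r3 N)) \<in> o(\<lambda>N. real N) \<and> (\<lambda>N. real (r3 N) / real N) \<longlonglongrightarrow> 0"
proof -
  have lim: "(\<lambda>N. real (r3 N) / real N) \<longlonglongrightarrow> 0"
  proof (rule LIMSEQ_I)
    fix e :: real assume "e > 0"
    \<comment> \<open>With density zero the bound is \<open>e / 2 * N + K\<close>, and
      \<open>K\<close> is less than \<open>e / 2 * N\<close> once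
      \<open>N > 2 * K / e\<close>.\<close>
    then obtain K where K: "K > 0" "\<And>N. real (r3 N) \<le> (r3_density + e / 2) * real N + K"
      using r3_le_density[of "e / 2"] by auto
    have "norm (real (r3 N) / real N - 0) < e" if N: "N \<ge> nat \<lceil>2 * K / e\<rceil> + 1" for N
    proof -
      have "real N > 2 * K / e"
        using N by linarith
      then have "2 * K < e * real N"
        using \<open>e > 0\<close> by (simp add: field_simps)
      then have "real (r3 N) < e * real N"
        using K(2)[of N] by (simp add: r3_density_eq_0)
      then show ?thesis
        using N by (simp add: field_simps)
    qed
    then show "\<exists>no. \<forall>N\<ge>no. norm (real (r3 N) / real N - 0) < e"
      by blast
  qed
  moreover have "(\<lambda>N. real (r3 N)) \<in> o(\<lambda>N. real N)"
    using lim by (intro smalloI_tendsto) (auto intro: eventually_gt_at_top[THEN eventually_mono])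
  ultimately show ?thesis
    by blast
qed

end
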